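(* Let $d\ge 1$, let $G_i=\{{S_i}_{t}: t\in\mathbb R_+\}$ be the weighted translation semigroup in $\mathcal B(L^2(\mathbb R_+))$ with symbol $\varphi_i$ for $1\le i\le d$, and let $t_1,\dots,t_d\in\mathbb R_+$. If the $d$-tuple $S_{\bf t}=({S_1}_{t_1},\cdots,{S_d}_{t_d})$ is commuting, then it is analytic, that is, $$\bigcap_{(k_1,\dots,k_d)\in\mathbb N^d}{S_1}_{t_1}^{k_1}\cdots{S_d}_{t_d}^{k_d}\,L^2(\mathbb R_+)=\{0\}.$$
   Context: $\mathbb R_+=[0,\infty)$ and $\mathbb N$ denotes the non-negative integers. For $1\le i\le d$, $\varphi_i$ is a positive continuous function on $\mathbb R_+$ such that for every $t\in\mathbb R_+$ the function ${\varphi_i}_t$ defined by ${\varphi_i}_t(x)=\sqrt{\varphi_i(x)/\varphi_i(x-t)}$ if $x\ge t$ and ${\varphi_i}_t(x)=0$ if $x<t$ is essentially bounded. For $t\in\mathbb R_+$ the bounded operator ${S_i}_t$ on $L^2(\mathbb R_+)$ is defined by ${S_i}_tf(x)={\varphi_i}_t(x)f(x-t)$ if $x\ge t$ and ${S_i}_tf(x)=0$ if $x<t$. The family $G_i=\{{S_i}_t:t\in\mathbb R_+\}$ is the weighted translation semigroup with symbol $\varphi_i$. A tuple is commuting if its entries commute pairwise. A commuting $d$-tuple $T=(T_1,\dots,T_d)$ on a Hilbert space $H$ is analytic if $\bigcap_{\alpha\in\mathbb N^d}T^\alpha H=\{0\}$, where $T^\alpha=T_1^{\alpha_1}\cdots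 T_d^{\alpha_d}$.
   Formalization: The formal theorem additionally assumes that some t_i is nonzero; if t_1 = … = t_d = 0, every operator is the identity, the tuple commutes and the intersection is all of L^2(R_+), so the statement as written fails in exactly that case. *)

theory Defs
  imports "HOL-Analysis.Analysis"
begin

section \<open>The Hilbert space of square integrable functions on the half line\<close>

abbreviation half_line :: "real measure"
  where "half_line \<equiv> lebesgue_on {0..}"

definition square_integrable :: "(real \<Rightarrow> complex) \<Rightarrow> bool"
  where "square_integrable f \<longleftrightarrow>
    f \<in> borel_measurable half_line \<and> integrable half_line (\<lambda>x. (cmod (f x))\<^sup>2)"

lemma square_integrable_measurable:
  "square_integrable f \<Longrightarrow> f \<in> borel_measurable half_line"
  by (simp add: square_integrable_def)

lemma square_integrable_bound:
  assumes "f \<in> borel_measurable half_line" "integrable half_line g"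
    and "AE x in half_line. (cmod (f x))\<^sup>2 \<le> g x"
  shows "square_integrable f"
  unfolding square_integrable_def
proof
  show "integrable half_line (\<lambda>x. (cmod (f x))\<^sup>2)"
  proof (rule Bochner_Integration.integrable_bound[OF assms(2)])
    show "(\<lambda>x. (cmod (f x))\<^sup>2) \<in> borel_measurable half_line"
      using assms(1) by measurable
    show "AE x in half_line. norm ((cmod (f x))\<^sup>2) \<le> norm (g x)"
      using assms(3) by eventually_elim auto
  qed
qed (rule assms(1))

lemma square_integrable_zero: "square_integrable (\<lambda>x. 0)"
  by (simp add: square_integrable_def)

lemma square_integrable_add:
  assumes "square_integrable f" "square_integrable g"
  shows "square_integrable (\<lambda>x. f x + g x)"
proof (rule square_integrable_bound)
  show "(\<lambda>x. f x + g x) \<in> borel_measurable half_line"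
    using assms[THEN square_integrable_measurable] by measurable
  show "integrable half_line (\<lambda>x. 2 * (cmod (f x))\<^sup>2 + 2 * (cmod (g x))\<^sup>2)"
    using assms unfolding square_integrable_def by auto
  have "(cmod (f x + g x))\<^sup>2 \<le> 2 * (cmod (f x))\<^sup>2 + 2 * (cmod (g x))\<^sup>2" for x
  proof -
    have "(cmod (f x + g x))\<^sup>2 \<le> (cmod (f x) + cmod (g x))\<^sup>2"
      by (intro power_mono norm_triangle_ineq) auto
    also have "\<dots> \<le> 2 * (cmod (f x))\<^sup>2 + 2 * (cmod (g x))\<^sup>2"
      using sum_squares_bound[of "cmod (f x)" "cmod (g x)"] by (simp add: power2_sum)
    finally show ?thesis .
  qed
  then show "AE x in half_line. (cmod (f x + g x))\<^sup>2 \<le> 2 * (cmod (f x))\<^sup>2 + 2 * (cmod (g x))\<^sup>2"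
    by simp
qed

lemma square_integrable_mult:
  assumes "square_integrable f"
  shows "square_integrable (\<lambda>x. c * f x)"
  using assms by (auto simp: square_integrable_def norm_mult power_mult_distrib)

lemma square_integrable_diff:
  assumes "square_integrable f" "square_integrable g"
  shows "square_integrable (\<lambda>x. f x - g x)"
  using square_integrable_add[OF assms(1) square_integrable_mult[OF assms(2), of "-1"]] by simp

lemma square_integrable_inner:
  assumes "square_integrable f" "square_integrable g"
  shows "integrable half_line (\<lambda>x. f x \<bullet> g x)"
proof (rule Bochner_Integration.integrable_bound)
  show "integrable half_line (\<lambda>x. (cmod (f x))\<^sup>2 + (cmod (g x))\<^sup>2)"
    using assms unfolding square_integrable_def by auto
  show "(\<lambda>x. f x \<bullet> g x) \<in> borel_measurable half_line"
    using assms[THEN square_integrable_measurable] by measurable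
  have "\<bar>f x \<bullet> g x\<bar> \<le> (cmod (f x))\<^sup>2 + (cmod (g x))\<^sup>2" for x
  proof -
    have "\<bar>f x \<bullet> g x\<bar> \<le> cmod (f x) * cmod (g x)"
      by (rule Cauchy_Schwarz_ineq2)
    also have "\<dots> \<le> (cmod (f x))\<^sup>2 + (cmod (g x))\<^sup>2"
      using sum_squares_bound[of "cmod (f x)" "cmod (g x)"]
        mult_nonneg_nonneg[of "cmod (f x)" "cmod (g x)"] by (simp del: mult_nonneg_nonneg)
    finally show ?thesis .
  qed
  then show "AE x in half_line. norm (f x \<bullet> g x) \<le> norm ((cmod (f x))\<^sup>2 + (cmod (g x))\<^sup>2)"
    by simp
qed

definition ae_equal :: "(real \<Rightarrow> complex) \<Rightarrow> (real \<Rightarrow> complex) \<Rightarrow> bool"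
  where "ae_equal f g \<longleftrightarrow>
    square_integrable f \<and> square_integrable g \<and> (AE x in half_line. f x = g x)"

quotient_type L2 = "real \<Rightarrow> complex" / partial: ae_equal
proof (rule part_equivpI)
  show "\<exists>f. ae_equal f f"
    using square_integrable_zero by (auto simp: ae_equal_def)
  show "symp ae_equal"
    by (auto intro!: sympI simp: ae_equal_def elim: AE_mp)
  show "transp ae_equal"
  proof (rule transpI)
    fix f g h assume *: "ae_equal f g" "ae_equal g h"
    have "AE x in half_line. f x = h x"
      using * unfolding ae_equal_def by (auto elim: AE_mp)
    then show "ae_equal f h" using * by (auto simp: ae_equal_def)
  qed
qed

instantiation L2 :: real_vector
begin

lift_definition zero_L2 :: L2 is "\<lambda>x. 0"
  by (simp add: ae_equal_def square_integrable_zero)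

lift_definition plus_L2 :: "L2 \<Rightarrow> L2 \<Rightarrow> L2" is "\<lambda>f g x. f x + g x"
  by (auto simp: ae_equal_def square_integrable_add)

lift_definition uminus_L2 :: "L2 \<Rightarrow> L2" is "\<lambda>f x. - f x"
  by (auto simp: ae_equal_def square_integrable_def)

lift_definition minus_L2 :: "L2 \<Rightarrow> L2 \<Rightarrow> L2" is "\<lambda>f g x. f x - g x"
  by (auto simp: ae_equal_def square_integrable_diff)

lift_definition scaleR_L2 :: "real \<Rightarrow> L2 \<Rightarrow> L2" is "\<lambda>r f x. complex_of_real r * f x"
  by (auto simp: ae_equal_def square_integrable_mult)

instance
proof
  fix a b c :: L2 and r s :: real
  show "a + b + c = a + (b + c)"
    by transfer (auto simp: ae_equal_def square_integrable_add add.assoc)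
  show "a + b = b + a"
    by transfer (auto simp: ae_equal_def square_integrable_add add.commute)
  show "0 + a = a"
    by transfer (auto simp: ae_equal_def)
  show "- a + a = 0"
    by transfer (auto simp: ae_equal_def square_integrable_zero)
  show "a - b = a + - b"
    by transfer (simp add: ae_equal_def square_integrable_diff)
  show "r *\<^sub>R (a + b) = r *\<^sub>R a + r *\<^sub>R b"
    by transfer (auto simp: ae_equal_def square_integrable_add square_integrable_mult distrib_left)
  show "(r + s) *\<^sub>R a = r *\<^sub>R a + s *\<^sub>R a"
    by transfer (auto simp: ae_equal_def square_integrable_add square_integrable_mult distrib_right)
  show "r *\<^sub>R s *\<^sub>R a = (r * s) *\<^sub>R a"
    by transfer (auto simp: ae_equal_def square_integrable_mult mult.assoc)
  show "1 *\<^sub>R a = a"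
    by transfer (auto simp: ae_equal_def)
qed

end

lift_definition scaleC :: "complex \<Rightarrow> L2 \<Rightarrow> L2" is "\<lambda>c f x. c * f x"
  by (auto simp: ae_equal_def square_integrable_mult)

instantiation L2 :: real_inner
begin

text \<open>On \<^typ>\<open>complex\<close>, \<open>z \<bullet> w\<close> is the real part of \<open>z * cnj w\<close>; so this is the real part of
  the complex scalar product, and it induces the usual norm.\<close>

lift_definition inner_L2 :: "L2 \<Rightarrow> L2 \<Rightarrow> real" is "\<lambda>f g. \<integral>x. f x \<bullet> g x \<partial>half_line"
  subgoal premises prems for f f' g g'
  proof (rule integral_cong_AE)
    show "AE x in half_line. f x \<bullet> g x = f' x \<bullet> g' x"
      using prems unfolding ae_equal_def by auto
  qed (use prems in \<open>auto simp: ae_equal_def dest!: square_integrable_inner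
        intro!: borel_measurable_inner square_integrable_measurable\<close>)
  done

definition norm_L2 :: "L2 \<Rightarrow> real"
  where "norm_L2 f = sqrt (f \<bullet> f)"

definition sgn_L2 :: "L2 \<Rightarrow> L2"
  where "sgn_L2 f = f /\<^sub>R norm f"

definition dist_L2 :: "L2 \<Rightarrow> L2 \<Rightarrow> real"
  where "dist_L2 f g = norm (f - g)"

definition uniformity_L2 :: "(L2 \<times> L2) filter"
  where "uniformity_L2 = (INF e\<in>{0<..}. principal {(f, g). dist f g < e})"

definition open_L2 :: "L2 set \<Rightarrow> bool"
  where "open_L2 U \<longleftrightarrow> (\<forall>f\<in>U. \<forall>\<^sub>F (f', g) in uniformity. f' = f \<longrightarrow> g \<in> U)"

instance
proof
  fix a b c :: L2 and r :: real and U :: "L2 set"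
  show "dist a b = norm (a - b)" by (rule dist_L2_def)
  show "sgn a = a /\<^sub>R norm a" by (rule sgn_L2_def)
  show "(uniformity :: (L2 \<times> L2) filter) = (INF e\<in>{0<..}. principal {(x, y). dist x y < e})"
    by (rule uniformity_L2_def)
  show "open U = (\<forall>x\<in>U. \<forall>\<^sub>F (x', y) in uniformity. x' = x \<longrightarrow> y \<in> U)"
    by (rule open_L2_def)
  show "norm a = sqrt (a \<bullet> a)" by (rule norm_L2_def)
  show "a \<bullet> b = b \<bullet> a"
    by transfer (simp add: inner_commute)
  show "(a + b) \<bullet> c = a \<bullet> c + b \<bullet> c"
    by transfer (simp add: inner_add_left ae_equal_def square_integrable_inner)
  show "(r *\<^sub>R a) \<bullet> b = r * (a \<bullet> b)"
  proof transfer
    fix r :: real and f g :: "real \<Rightarrow> complex"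
    have "(complex_of_real r * f x) \<bullet> g x = r * (f x \<bullet> g x)" for x
      by (simp flip: scaleR_conv_of_real)
    then show "(\<integral>x. (complex_of_real r * f x) \<bullet> g x \<partial>half_line) = r * (\<integral>x. f x \<bullet> g x \<partial>half_line)"
      by simp
  qed
  show "0 \<le> a \<bullet> a"
    by transfer simp
  show "a \<bullet> a = 0 \<longleftrightarrow> a = 0"
  proof transfer
    fix f assume "ae_equal f f"
    then have f: "square_integrable f" by (simp add: ae_equal_def)
    have "(\<integral>x. f x \<bullet> f x \<partial>half_line) = 0 \<longleftrightarrow> (AE x in half_line. f x \<bullet> f x = 0)"
      by (rule integral_nonneg_eq_0_iff_AE) (use square_integrable_inner[OF f f] in auto)
    also have "\<dots> \<longleftrightarrow> ae_equal f (\<lambda>x. 0)"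
      using f by (simp add: ae_equal_def square_integrable_zero)
    finally show "(\<integral>x. f x \<bullet> f x \<partial>half_line) = 0 \<longleftrightarrow> ae_equal f (\<lambda>x. 0)" .
  qed
qed

end

section \<open>Weighted translation semigroups\<close>

definition translation_weight :: "(real \<Rightarrow> real) \<Rightarrow> real \<Rightarrow> real \<Rightarrow> real"
  where "translation_weight \<phi> t x = (if t \<le> x then sqrt (\<phi> x / \<phi> (x - t)) else 0)"

definition translation_symbol :: "(real \<Rightarrow> real) \<Rightarrow> bool"
  where "translation_symbol \<phi> \<longleftrightarrow>
    continuous_on {0..} \<phi> \<and> (\<forall>x\<ge>0. 0 < \<phi> x) \<and>
    (\<forall>t\<ge>0. \<exists>C. AE x in half_line. \<bar>translation_weight \<phi> t x\<bar> \<le> C)"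

definition weighted_translate ::
    "(real \<Rightarrow> real) \<Rightarrow> real \<Rightarrow> (real \<Rightarrow> complex) \<Rightarrow> real \<Rightarrow> complex"
  where "weighted_translate \<phi> t f x =
    (if t \<le> x then complex_of_real (translation_weight \<phi> t x) * f (x - t) else 0)"

text \<open>The value does not depend on the chosen representative as soon as \<open>\<phi>\<close> is a symbol and
  \<open>t \<ge> 0\<close>: see \<open>weighted_translation_abs\<close> below.\<close>

definition weighted_translation :: "(real \<Rightarrow> real) \<Rightarrow> real \<Rightarrow> L2 \<Rightarrow> L2"
  where "weighted_translation \<phi> t F = abs_L2 (weighted_translate \<phi> t (rep_L2 F))"

text \<open>Translation to the right on the half line, extended by zero.\<close>

lemma integrable_shift:
  fixes g :: "real \<Rightarrow> real"
  assumes "integrable half_line g" "0 \<le> t"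
  shows "integrable half_line (\<lambda>x. if t \<le> x then g (x - t) else 0)" (is ?A)
    and "(\<integral>x. (if t \<le> x then g (x - t) else 0) \<partial>half_line) = (\<integral>x. g x \<partial>half_line)" (is ?B)
proof -
  define h where "h x = indicator {0..} x *\<^sub>R g x" for x
  have h: "has_bochner_integral lebesgue h (\<integral>x. g x \<partial>half_line)"
    unfolding h_def
    using has_bochner_integral_restrict_space[of "{0..}" lebesgue g "\<integral>x. g x \<partial>half_line"] assms(1)
    by (simp add: has_bochner_integral_integrable)
  have "(\<lambda>x. h (- t + 1 * x)) =
      (\<lambda>x. indicator {0..} x *\<^sub>R (if t \<le> x then g (x - t) else 0))"
    using assms(2) by (auto simp: h_def indicator_def fun_eq_iff)
  moreover have "has_bochner_integral lebesgue (\<lambda>x. h (- t + 1 * x)) (\<integral>x. g x \<partial>half_line)"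
    using h has_bochner_integral_lebesgue_real_affine_iff[of 1 h "\<integral>x. g x \<partial>half_line" "-t"] by simp
  ultimately have "has_bochner_integral half_line (\<lambda>x. if t \<le> x then g (x - t) else 0)
      (\<integral>x. g x \<partial>half_line)"
    by (simp add: has_bochner_integral_restrict_space)
  then show ?A ?B by (auto simp: has_bochner_integral_iff)
qed

lemma shift_measurable: "(\<lambda>x::real. x - t) \<in> lebesgue \<rightarrow>\<^sub>M lebesgue"
  using lebesgue_affine_measurable[of "\<lambda>_. 1" "- t"] by simp

lemma measurable_shift:
  fixes f :: "real \<Rightarrow> complex"
  assumes "f \<in> borel_measurable half_line" "0 \<le> t"
  shows "(\<lambda>x. if t \<le> x then f (x - t) else 0) \<in> borel_measurable half_line"
proof -
  have "(\<lambda>x. if x \<in> {0..} then f x else 0) \<in> borel_measurable lebesgue"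
    using assms(1) by (intro borel_measurable_if_I) auto
  then have "(\<lambda>x. if x - t \<in> {0..} then f (x - t) else 0) \<in> borel_measurable lebesgue"
    using measurable_compose[OF shift_measurable] by blast
  then show ?thesis
    by (auto intro: measurable_restrict_space1)
qed

lemma AE_shift:
  assumes "AE x in half_line. P x" "0 \<le> t"
  shows "AE x in half_line. t \<le> x \<longrightarrow> P (x - t)"
proof -
  have "AE x in lebesgue. x \<in> {0..} \<longrightarrow> P x"
    using assms(1) by (simp add: AE_restrict_space_iff)
  then have "AE x in lborel. x \<in> {0..} \<longrightarrow> P x"
    by (simp add: AE_completion_iff)
  then obtain N where N: "N \<in> null_sets lborel" "{x. \<not> (x \<in> {0..} \<longrightarrow> P x)} \<subseteq> N"
    by (auto simp: eventually_ae_filter)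
  have "AE x in lborel. x - t \<in> {0..} \<longrightarrow> P (x - t)"
    by (rule AE_I'[OF null_sets_translation[OF N(1), of t]]) (use N(2) in auto)
  then have "AE x in lebesgue. x - t \<in> {0..} \<longrightarrow> P (x - t)"
    by (rule AE_completion)
  then show ?thesis
    by (auto simp: AE_restrict_space_iff elim: AE_mp)
qed

lemma translation_weight_measurable:
  assumes "translation_symbol \<phi>" "0 \<le> t"
  shows "translation_weight \<phi> t \<in> borel_measurable half_line"
proof -
  have \<phi>: "continuous_on {0..} \<phi>" and pos: "\<And>x. 0 \<le> x \<Longrightarrow> 0 < \<phi> x"
    using assms(1) by (auto simp: translation_symbol_def)
  have "continuous_on {t..} \<phi>"
    by (rule continuous_on_subset[OF \<phi>]) (use assms(2) in auto)
  moreover have "continuous_on {t..} (\<lambda>x. \<phi> (x - t))"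
    by (rule continuous_on_compose2[OF \<phi>]) (auto intro!: continuous_intros)
  moreover have "\<phi> (x - t) \<noteq> 0" if "x \<in> {t..}" for x
    using pos[of "x - t"] that by auto
  ultimately have "continuous_on {t..} (\<lambda>x. sqrt (\<phi> x / \<phi> (x - t)))"
    by (intro continuous_on_real_sqrt continuous_on_divide ballI)
  then have "(\<lambda>x. sqrt (\<phi> x / \<phi> (x - t))) \<in> borel_measurable (lebesgue_on {t..})"
    by (rule continuous_imp_measurable_on_sets_lebesgue) auto
  then have "(\<lambda>x. if x \<in> {t..} then sqrt (\<phi> x / \<phi> (x - t)) else 0) \<in> borel_measurable lebesgue"
    by (intro borel_measurable_if_I) auto
  then show ?thesis
    unfolding translation_weight_def[abs_def] by (auto intro: measurable_restrict_space1)
qed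

lemma weighted_translate_measurable:
  assumes "translation_symbol \<phi>" "0 \<le> t" "f \<in> borel_measurable half_line"
  shows "weighted_translate \<phi> t f \<in> borel_measurable half_line"
proof -
  have "(\<lambda>x. complex_of_real (translation_weight \<phi> t x) * (if t \<le> x then f (x - t) else 0))
      \<in> borel_measurable half_line"
    using translation_weight_measurable[OF assms(1,2)] measurable_shift[OF assms(3,2)]
    by (intro borel_measurable_times measurable_compose[OF _ borel_measurable_of_real])
  also have "(\<lambda>x. complex_of_real (translation_weight \<phi> t x) * (if t \<le> x then f (x - t) else 0)) =
      weighted_translate \<phi> t f"
    by (simp add: weighted_translate_def fun_eq_iff)
  finally show ?thesis .
qed

lemma weighted_translate_bound:
  assumes "AE x in half_line. \<bar>translation_weight \<phi> t x\<bar> \<le> C"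
  shows "AE x in half_line. (cmod (weighted_translate \<phi> t f x))\<^sup>2 \<le>
    C\<^sup>2 * (if t \<le> x then (cmod (f (x - t)))\<^sup>2 else 0)"
  using assms
proof eventually_elim
  case (elim x)
  have "\<bar>translation_weight \<phi> t x\<bar>\<^sup>2 \<le> C\<^sup>2"
    by (rule power_mono[OF elim]) simp
  then have "(translation_weight \<phi> t x)\<^sup>2 * (cmod (f (x - t)))\<^sup>2 \<le> C\<^sup>2 * (cmod (f (x - t)))\<^sup>2"
    unfolding power2_abs by (rule mult_right_mono) simp
  then show ?case
    by (cases "t \<le> x") (simp_all add: weighted_translate_def norm_mult power_mult_distrib
        del: mult_le_cancel_right)
qed

lemma square_integrable_weighted_translate:
  assumes "translation_symbol \<phi>" "0 \<le> t" "square_integrable f"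
  shows "square_integrable (weighted_translate \<phi> t f)"
proof -
  obtain C where C: "AE x in half_line. \<bar>translation_weight \<phi> t x\<bar> \<le> C"
    using assms(1,2) unfolding translation_symbol_def by blast
  show ?thesis
  proof (rule square_integrable_bound[OF _ _ weighted_translate_bound[OF C]])
    show "weighted_translate \<phi> t f \<in> borel_measurable half_line"
      by (rule weighted_translate_measurable[OF assms(1,2) square_integrable_measurable[OF assms(3)]])
    have "integrable half_line (\<lambda>x. (cmod (f x))\<^sup>2)"
      using assms(3) by (simp add: square_integrable_def)
    then show "integrable half_line (\<lambda>x. C\<^sup>2 * (if t \<le> x then (cmod (f (x - t)))\<^sup>2 else 0))"
      by (intro integrable_mult_right integrable_shift(1) assms(2))
  qed
qed

lemma ae_equal_weighted_translate:
  assumes "translation_symbol \<phi>" "0 \<le> t" "ae_equal f g"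
  shows "ae_equal (weighted_translate \<phi> t f) (weighted_translate \<phi> t g)"
proof -
  have "AE x in half_line. t \<le> x \<longrightarrow> f (x - t) = g (x - t)"
    using assms(2,3) by (intro AE_shift) (auto simp: ae_equal_def)
  then have "AE x in half_line. weighted_translate \<phi> t f x = weighted_translate \<phi> t g x"
    by eventually_elim (auto simp: weighted_translate_def)
  then show ?thesis
    using assms square_integrable_weighted_translate by (auto simp: ae_equal_def)
qed

lemma weighted_translation_abs:
  assumes "translation_symbol \<phi>" "0 \<le> t" "square_integrable f"
  shows "weighted_translation \<phi> t (abs_L2 f) = abs_L2 (weighted_translate \<phi> t f)"
proof -
  have "ae_equal (rep_L2 (abs_L2 f)) f"
    using assms(3) Quotient3_rep_abs[OF Quotient3_L2] by (auto simp: ae_equal_def)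
  then have "ae_equal (weighted_translate \<phi> t (rep_L2 (abs_L2 f))) (weighted_translate \<phi> t f)"
    by (rule ae_equal_weighted_translate[OF assms(1,2)])
  then show ?thesis
    unfolding weighted_translation_def using Quotient3_rel_abs[OF Quotient3_L2] by blast
qed

lemma weighted_translation_transfer:
  assumes "translation_symbol \<phi>" "0 \<le> t"
  shows "rel_fun (pcr_L2) (pcr_L2) (weighted_translate \<phi> t) (weighted_translation \<phi> t)"
proof (rule rel_funI)
  fix f F assume "pcr_L2 f F"
  then have f: "ae_equal f f" and F: "F = abs_L2 f"
    by (auto simp: pcr_L2_def cr_L2_def relcompp_apply rel_fun_eq)
  then show "pcr_L2 (weighted_translate \<phi> t f) (weighted_translation \<phi> t F)"
    using ae_equal_weighted_translate[OF assms f] weighted_translation_abs[OF assms, of f]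
    by (auto simp: pcr_L2_def cr_L2_def relcompp_apply rel_fun_eq ae_equal_def)
qed

lemma weighted_translate_add:
  "weighted_translate \<phi> t (\<lambda>x. f x + g x) =
    (\<lambda>x. weighted_translate \<phi> t f x + weighted_translate \<phi> t g x)"
  by (auto simp: weighted_translate_def fun_eq_iff distrib_left)

lemma weighted_translate_mult:
  "weighted_translate \<phi> t (\<lambda>x. c * f x) = (\<lambda>x. c * weighted_translate \<phi> t f x)"
  by (auto simp: weighted_translate_def fun_eq_iff)

lemma bounded_linear_weighted_translation:
  assumes "translation_symbol \<phi>" "0 \<le> t"
  shows "bounded_linear (weighted_translation \<phi> t)"
proof -
  note [transfer_rule] = weighted_translation_transfer[OF assms]
  note sq = square_integrable_weighted_translate[OF assms]
  obtain C where C: "AE x in half_line. \<bar>translation_weight \<phi> t x\<bar> \<le> C"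
    using assms unfolding translation_symbol_def by blast
  show ?thesis
  proof (rule bounded_linear_intro)
    fix F G :: L2 and r :: real
    show "weighted_translation \<phi> t (F + G) = weighted_translation \<phi> t F + weighted_translation \<phi> t G"
      by transfer (simp add: ae_equal_def weighted_translate_add sq square_integrable_add)
    show "weighted_translation \<phi> t (r *\<^sub>R F) = r *\<^sub>R weighted_translation \<phi> t F"
      by transfer (simp add: ae_equal_def weighted_translate_mult sq square_integrable_mult)
    have "weighted_translation \<phi> t F \<bullet> weighted_translation \<phi> t F \<le> C\<^sup>2 * (F \<bullet> F)"
    proof (transfer fixing: \<phi> t C)
      fix f assume "ae_equal f f"
      then have f: "square_integrable f" by (simp add: ae_equal_def)
      then have int: "integrable half_line (\<lambda>x. (cmod (f x))\<^sup>2)"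
        by (simp add: square_integrable_def)
      have "(\<integral>x. (cmod (weighted_translate \<phi> t f x))\<^sup>2 \<partial>half_line)
          \<le> (\<integral>x. C\<^sup>2 * (if t \<le> x then (cmod (f (x - t)))\<^sup>2 else 0) \<partial>half_line)"
      proof (rule integral_mono_AE[OF _ _ weighted_translate_bound[OF C]])
        show "integrable half_line (\<lambda>x. (cmod (weighted_translate \<phi> t f x))\<^sup>2)"
          using sq[OF f] by (simp add: square_integrable_def)
        show "integrable half_line (\<lambda>x. C\<^sup>2 * (if t \<le> x then (cmod (f (x - t)))\<^sup>2 else 0))"
          by (intro integrable_mult_right integrable_shift(1) assms(2) int)
      qed
      also have "\<dots> = C\<^sup>2 * (\<integral>x. (cmod (f x))\<^sup>2 \<partial>half_line)"
        unfolding integral_mult_right_zero integrable_shift(2)[OF int assms(2)] ..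
      finally show "(\<integral>x. weighted_translate \<phi> t f x \<bullet> weighted_translate \<phi> t f x \<partial>half_line)
          \<le> C\<^sup>2 * (\<integral>x. f x \<bullet> f x \<partial>half_line)"
        by (simp only: dot_square_norm)
    qed
    then have "sqrt (weighted_translation \<phi> t F \<bullet> weighted_translation \<phi> t F) \<le> sqrt (C\<^sup>2 * (F \<bullet> F))"
      by (rule real_sqrt_le_mono)
    then show "norm (weighted_translation \<phi> t F) \<le> norm F * \<bar>C\<bar>"
      by (simp add: norm_L2_def real_sqrt_mult mult.commute)
  qed
qed

lemma weighted_translation_scaleC:
  assumes "translation_symbol \<phi>" "0 \<le> t"
  shows "weighted_translation \<phi> t (scaleC c F) = scaleC c (weighted_translation \<phi> t F)"
proof -
  note [transfer_rule] = weighted_translation_transfer[OF assms]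
  note sq = square_integrable_weighted_translate[OF assms]
  show ?thesis
    by transfer (simp add: ae_equal_def weighted_translate_mult sq square_integrable_mult)
qed

section \<open>Tuples of operators\<close>

text \<open>A \<open>d\<close>-tuple is given by its entries \<open>T 1, \<dots>, T d\<close>; other values of \<open>T\<close> are irrelevant.\<close>

definition commuting_tuple :: "nat \<Rightarrow> (nat \<Rightarrow> 'a \<Rightarrow> 'a) \<Rightarrow> bool"
  where "commuting_tuple d T \<longleftrightarrow> (\<forall>i\<in>{1..d}. \<forall>j\<in>{1..d}. T i \<circ> T j = T j \<circ> T i)"

definition tuple_power :: "nat \<Rightarrow> (nat \<Rightarrow> 'a \<Rightarrow> 'a) \<Rightarrow> (nat \<Rightarrow> nat) \<Rightarrow> 'a \<Rightarrow> 'a"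
  where "tuple_power d T \<alpha> = foldr (\<lambda>i A. (T i ^^ \<alpha> i) \<circ> A) [1..<Suc d] id"

definition analytic_tuple :: "nat \<Rightarrow> (nat \<Rightarrow> 'a \<Rightarrow> 'a::real_inner) \<Rightarrow> bool"
  where "analytic_tuple d T \<longleftrightarrow> (\<Inter>\<alpha>. range (tuple_power d T \<alpha>)) = {0}"

text \<open>Time zero gives the identity operator, so the tuple with all times zero is never analytic.\<close>

lemma weighted_translation_0:
  assumes "translation_symbol \<phi>"
  shows "weighted_translation \<phi> 0 = id"
proof
  note [transfer_rule] = weighted_translation_transfer[OF assms order_refl]
  fix F
  show "weighted_translation \<phi> 0 F = id F"
    unfolding id_apply
  proof (transfer fixing: \<phi>)
    fix f assume f: "ae_equal f f"
    have "AE x in half_line. weighted_translate \<phi> 0 f x = f x"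
      using assms by (intro AE_I2)
        (auto simp: weighted_translate_def translation_weight_def translation_symbol_def
          space_restrict_space less_imp_neq[THEN not_sym])
    then show "ae_equal (weighted_translate \<phi> 0 f) f"
      using f ae_equal_weighted_translate[OF assms order_refl f] by (auto simp: ae_equal_def)
  qed
qed

lemma L2_nontrivial: "\<exists>F :: L2. F \<noteq> 0"
proof -
  let ?f = "\<lambda>x::real. complex_of_real (indicator {0..1} x)"
  have [simp]: "emeasure half_line {0..1} = 1"
    by (subst emeasure_restrict_space) auto
  have m: "{0..1} \<in> sets half_line"
    by (auto simp: sets_restrict_space_iff)
  have "(\<lambda>x. (cmod (?f x))\<^sup>2) = indicator {0..1}"
    by (auto simp: indicator_def)
  then have f: "square_integrable ?f"
    using m by (auto simp: square_integrable_def)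
  have "\<not> (AE x in half_line. ?f x = 0)"
  proof
    assume "AE x in half_line. ?f x = 0"
    then have "AE x in half_line. x \<notin> {0..1}"
      by eventually_elim (auto simp: indicator_def split: if_splits)
    then have "emeasure half_line {0..1} = 0"
      using m AE_iff_null_sets by blast
    then show False by simp
  qed
  then have "\<not> ae_equal ?f (\<lambda>x. 0)" by (simp add: ae_equal_def)
  then have "abs_L2 ?f \<noteq> 0"
    using f square_integrable_zero Quotient3_rel[OF Quotient3_L2, of ?f "\<lambda>x. 0"]
    by (auto simp: zero_L2_def ae_equal_def)
  then show ?thesis ..
qed

lemma not_analytic_tuple_time_0:
  assumes "\<And>i. i \<in> {1..d} \<Longrightarrow> translation_symbol (\<phi> i)"
    and "\<And>i. i \<in> {1..d} \<Longrightarrow> t i = 0"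
  shows "\<not> analytic_tuple d (\<lambda>i. weighted_translation (\<phi> i) (t i))"
proof -
  have *: "set xs \<subseteq> {1..d} \<Longrightarrow>
      foldr (\<lambda>i A. (weighted_translation (\<phi> i) (t i) ^^ \<alpha> i) \<circ> A) xs id = id" for xs \<alpha>
    by (induction xs) (auto simp: assms weighted_translation_0 simp flip: id_def)
  have "tuple_power d (\<lambda>i. weighted_translation (\<phi> i) (t i)) \<alpha> = id" for \<alpha>
    unfolding tuple_power_def by (rule *) auto
  then show ?thesis
    using L2_nontrivial by (auto simp: analytic_tuple_def)
qed

end

theory Submission
  imports Defs
begin

text \<open>The obstruction to lying in all the ranges is the start of the support. A weighted translation
  by \<open>t \<ge> 0\<close>, whatever its weight, moves supports to the right by \<open>t\<close>, so an element of the range of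
  the power of index \<open>\<alpha>\<close> vanishes almost everywhere on \<open>[0, s)\<close>, where \<open>s = (\<Sum>i=1..d. \<alpha> i * t i)\<close>
  (lemma \<open>tuple_power_vanishes_before\<close>). Since some \<open>t i\<close> is positive, \<open>s\<close> takes arbitrarily large
  values as \<open>\<alpha>\<close> varies. An element of all the ranges therefore vanishes almost everywhere on the
  half line. Conversely, \<open>0\<close> lies in every range by linearity.\<close>

lift_definition vanishes_before :: "real \<Rightarrow> L2 \<Rightarrow> bool"
  is "\<lambda>s f. AE x in half_line. x < s \<longrightarrow> f x = 0"
  by (auto simp: ae_equal_def elim: AE_mp)

text \<open>Every element satisfies the condition at \<open>s = 0\<close>, because the measure lives on the half line;
  this starts the inductions below.\<close>

lemma vanishes_before_0: "vanishes_before 0 F"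
  by transfer (auto intro!: AE_I2 simp: space_restrict_space)

lemma vanishes_before_weighted_translation:
  assumes "translation_symbol \<phi>" "0 \<le> t" "vanishes_before s F"
  shows "vanishes_before (t + s) (weighted_translation \<phi> t F)"
proof -
  note [transfer_rule] = weighted_translation_transfer[OF assms(1,2)]
  show ?thesis
    using assms(3)
  proof (transfer fixing: \<phi> t s)
    fix f :: "real \<Rightarrow> complex"
    assume "AE x in half_line. x < s \<longrightarrow> f x = 0"
    then have "AE x in half_line. t \<le> x \<longrightarrow> x - t < s \<longrightarrow> f (x - t) = 0"
      using assms(2) by (rule AE_shift)
    then show "AE x in half_line. x < t + s \<longrightarrow> weighted_translate \<phi> t f x = 0"
      by eventually_elim (auto simp: weighted_translate_def)
  qed
qed

lemma vanishes_before_weighted_translation_funpow: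
  assumes "translation_symbol \<phi>" "0 \<le> t" "vanishes_before s F"
  shows "vanishes_before (real n * t + s) ((weighted_translation \<phi> t ^^ n) F)"
proof (induction n)
  case 0
  show ?case using assms(3) by simp
next
  case (Suc n)
  show ?case
    using vanishes_before_weighted_translation[OF assms(1,2) Suc] by (simp add: algebra_simps)
qed

lemma tuple_power_vanishes_before:
  assumes "\<And>i. i \<in> {1..d} \<Longrightarrow> translation_symbol (\<phi> i)"
    and "\<And>i. i \<in> {1..d} \<Longrightarrow> 0 \<le> t i"
  shows "vanishes_before (\<Sum>i=1..d. real (\<alpha> i) * t i)
    (tuple_power d (\<lambda>i. weighted_translation (\<phi> i) (t i)) \<alpha> F)"
proof -
  \<comment> \<open>The product of operators is a fold over the list of indices: induction needs arbitrary sublists.\<close>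
  have "vanishes_before (\<Sum>i\<leftarrow>xs. real (\<alpha> i) * t i)
      (foldr (\<lambda>i A. (weighted_translation (\<phi> i) (t i) ^^ \<alpha> i) \<circ> A) xs id F)"
    if "set xs \<subseteq> {1..d}" for xs
    using that
    by (induction xs)
      (auto simp: vanishes_before_0 intro!: vanishes_before_weighted_translation_funpow assms)
  from this[of "[1..<Suc d]"] show ?thesis
    unfolding tuple_power_def
    by (auto simp: sum_list_distinct_conv_sum_set atLeastLessThanSuc_atLeastAtMost
        simp del: upt_Suc)
qed

lemma vanishes_before_multiples_imp_0:
  assumes "0 < r" "\<And>k::nat. vanishes_before (real k * r) F"
  shows "F = 0"
  using assms(2)
proof (transfer fixing: r)
  fix f :: "real \<Rightarrow> complex"
  assume f: "ae_equal f f"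
    and "\<And>k. AE x in half_line. x < real k * r \<longrightarrow> f x = 0"
  \<comment> \<open>Countably many bounds, so the exceptional null sets can be joined.\<close>
  then have "AE x in half_line. \<forall>k. x < real k * r \<longrightarrow> f x = 0"
    unfolding AE_all_countable by blast
  then have "AE x in half_line. f x = 0"
    by eventually_elim (meson reals_Archimedean3[OF assms(1)])
  with f show "ae_equal f (\<lambda>x. 0)"
    by (simp add: ae_equal_def square_integrable_zero)
qed

lemma tuple_power_weighted_translation_0:
  assumes "\<And>i. i \<in> {1..d} \<Longrightarrow> translation_symbol (\<phi> i)"
    and "\<And>i. i \<in> {1..d} \<Longrightarrow> 0 \<le> t i"
  shows "tuple_power d (\<lambda>i. weighted_translation (\<phi> i) (t i)) \<alpha> 0 = 0"
proof -
  have T: "weighted_translation (\<phi> i) (t i) 0 = 0" if "i \<in> {1..d}" for i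
    using bounded_linear_weighted_translation[OF assms(1)[OF that] assms(2)[OF that]]
    by (rule bounded_linear.linear[THEN linear_0])
  have T_pow: "(weighted_translation (\<phi> i) (t i) ^^ n) 0 = 0" if "i \<in> {1..d}" for i n
    by (induction n) (simp_all add: T[OF that])
  have "foldr (\<lambda>i A. (weighted_translation (\<phi> i) (t i) ^^ \<alpha> i) \<circ> A) xs id 0 = 0"
    if "set xs \<subseteq> {1..d}" for xs
    using that by (induction xs) (auto simp: T_pow)
  from this[of "[1..<Suc d]"] show ?thesis
    unfolding tuple_power_def by (auto simp: atLeastLessThanSuc_atLeastAtMost simp del: upt_Suc)
qed

theorem proposition3p1:
  fixes d :: nat and \<phi> :: "nat \<Rightarrow> real \<Rightarrow> real" and t :: "nat \<Rightarrow> real"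
  assumes "d \<ge> 1"
    and "\<And>i. i \<in> {1..d} \<Longrightarrow> translation_symbol (\<phi> i)"
    and "\<And>i. i \<in> {1..d} \<Longrightarrow> t i \<ge> 0"
    and "\<exists>i\<in>{1..d}. t i \<noteq> 0"
    and "commuting_tuple d (\<lambda>i. weighted_translation (\<phi> i) (t i))"
  shows "analytic_tuple d (\<lambda>i. weighted_translation (\<phi> i) (t i))"
proof -
  let ?P = "tuple_power d (\<lambda>i. weighted_translation (\<phi> i) (t i))"
  have "?P \<alpha> 0 = 0" for \<alpha>
    using assms(2,3) by (rule tuple_power_weighted_translation_0)
  then have "0 \<in> range (?P \<alpha>)" for \<alpha>
    by (rule range_eqI[OF sym])
  moreover have "F = 0" if F: "\<And>\<alpha>. F \<in> range (?P \<alpha>)" for F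
  proof (rule vanishes_before_multiples_imp_0)
    obtain i where i: "i \<in> {1..d}" "t i \<noteq> 0"
      using assms(4) by blast
    with assms(3) show "0 < (\<Sum>i=1..d. t i)"
      by (intro sum_pos2[of _ i]) (auto simp: less_le)
    fix k :: nat
    \<comment> \<open>The constant multi-index \<open>k\<close> already gives supports that start arbitrarily far out.\<close>
    obtain G where "F = ?P (\<lambda>_. k) G"
      using F[of "\<lambda>_. k"] by (rule rangeE)
    moreover have "vanishes_before (\<Sum>i=1..d. real k * t i) (?P (\<lambda>_. k) G)"
      using assms(2,3) by (rule tuple_power_vanishes_before)
    ultimately show "vanishes_before (real k * (\<Sum>i=1..d. t i)) F"
      by (simp only: sum_distrib_left)
  qed
  ultimately show ?thesis
    unfolding analytic_tuple_def by blast
qed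

end
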